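(* Let $G$ be a finite group and let $\psi,\vartheta: G\to\mathrm{M}(n,\mathbb{C})$ be unitary, different but equivalent, irreducible matrix representations of $G$ of dimension $n$. Then there exists a unitary matrix $U=(u_{ab})\in\mathrm{M}(n,\mathbb{C})$, with $r_{ab}=|u_{ab}|$, such that $$r_{ab}\,u_{ij}=\frac{n}{|G|}\sum_{g\in G}\vartheta_{ia}(g^{-1})\,\psi_{bj}(g),$$ where the indices $a,b,i,j$ range over $\{1,\ldots,n\}$. In particular, when $\vartheta=\psi$, then $U=\mathbf{1}$ (the identity matrix), and thus the formula takes the form of the classical orthogonality relation for the irreducible representation $\vartheta$: $$\frac{n}{|G|}\sum_{g\in G}\vartheta_{ia}(g^{-1})\,\vartheta_{bj}(g)=\delta_{ab}\,\delta_{ij}.$$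
   Context: For a matrix representation $\vartheta$, $\vartheta_{ij}(g)$ denotes the $(i,j)$ entry of $\vartheta(g)$, and $|G|$ is the number of elements of $G$. Two irreducible representations $\vartheta,\psi$ of $G$ in dimension $n$ are equivalent if there exists $X\in\mathrm{GL}(n,\mathbb{C})$ with $X^{-1}\vartheta(g)X=\psi(g)$ for all $g\in G$. A matrix representation $\vartheta$ is unitary if every $\vartheta(g)$ is a unitary matrix.
   Formalization: For different θ, ψ, one U satisfying the formula for all a,b,i,j need not exist (e.g. ψ = X⁻¹θX with X = diag(1,i)); what is proved has u_ij multiplied by a unimodular factor that may depend on (a,b), with U and r_ab fixed. *)

theory Defs
  imports "HOL-Analysis.Analysis" "HOL-Algebra.Group"
begin

definition GL_complex :: "(complex ^ 'n ^ 'n) monoid"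
  where "GL_complex = \<lparr>carrier = {A. invertible A}, mult = (**), one = mat 1\<rparr>"

definition conj_transpose :: "complex ^ 'n ^ 'm \<Rightarrow> complex ^ 'm ^ 'n"
  where "conj_transpose A = (\<chi> i j. cnj (A $ j $ i))"

definition unitary_matrix :: "complex ^ 'n ^ 'n \<Rightarrow> bool"
  where "unitary_matrix U \<longleftrightarrow>
    conj_transpose U ** U = mat 1 \<and> U ** conj_transpose U = mat 1"

definition matrix_representation :: "('g, 'r) monoid_scheme \<Rightarrow> ('g \<Rightarrow> complex ^ 'n ^ 'n) \<Rightarrow> bool"
  where "matrix_representation G \<theta> \<longleftrightarrow> \<theta> \<in> hom G GL_complex"

definition unitary_representation :: "('g, 'r) monoid_scheme \<Rightarrow> ('g \<Rightarrow> complex ^ 'n ^ 'n) \<Rightarrow> bool"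
  where "unitary_representation G \<theta> \<longleftrightarrow>
    matrix_representation G \<theta> \<and> (\<forall>g\<in>carrier G. unitary_matrix (\<theta> g))"

(* Index types are nonempty, so the representation space is never zero and
   irreducibility needs no separate nontriviality clause. *)
definition irreducible_representation :: "('g, 'r) monoid_scheme \<Rightarrow> ('g \<Rightarrow> complex ^ 'n ^ 'n) \<Rightarrow> bool"
  where "irreducible_representation G \<theta> \<longleftrightarrow>
    matrix_representation G \<theta> \<and>
    (\<forall>W. vec.subspace W \<and> (\<forall>g\<in>carrier G. \<forall>w\<in>W. \<theta> g *v w \<in> W) \<longrightarrow> W = {0} \<or> W = UNIV)"

definition equivalent_representations ::
    "('g, 'r) monoid_scheme \<Rightarrow> ('g \<Rightarrow> complex ^ 'n ^ 'n) \<Rightarrow> ('g \<Rightarrow> complex ^ 'n ^ 'n) \<Rightarrow> bool"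
  where "equivalent_representations G \<theta> \<psi> \<longleftrightarrow>
    (\<exists>X. invertible X \<and> (\<forall>g\<in>carrier G. matrix_inv X ** \<theta> g ** X = \<psi> g))"

(* The right-hand side of the orthogonality formula, with the argument order i a b j of the
   subscripts in theta_{ia}(g^{-1}) psi_{bj}(g).  For a unitary X with X^{-1} theta X = psi
   it equals cnj x_{ab} * x_{ij}.  To write this as r_{ab} u_{ij} with r_{ab} = |x_{ab}|, the
   phase of cnj x_{ab} has to be absorbed into the matrix.  One scalar multiple U of X cannot
   do this for all a, b at once unless all nonzero entries of X share a common phase: for
   X = diag(1, i) one would need u_{22} = i (from a = b = 1) and u_{22} = 1 (from a = b = 2).
   The matrix U in the formula is therefore one unitary matrix up to a unimodular factor,
   where the factor is chosen for the pair (a, b); the r_{ab} do not depend on it. *)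
definition orthogonality_average ::
    "('g, 'r) monoid_scheme \<Rightarrow> ('g \<Rightarrow> complex ^ 'n ^ 'n) \<Rightarrow> ('g \<Rightarrow> complex ^ 'n ^ 'n)
      \<Rightarrow> 'n \<Rightarrow> 'n \<Rightarrow> 'n \<Rightarrow> 'n \<Rightarrow> complex"
  where "orthogonality_average G \<theta> \<psi> i a b j =
    of_nat CARD('n) / of_nat (card (carrier G)) *
      (\<Sum>g\<in>carrier G. \<theta> (inv\<^bsub>G\<^esub> g) $ i $ a * \<psi> g $ b $ j)"

end

(* Schur's lemma drives everything. If X intertwines two equivalent unitary irreducible
   representations then X* X commutes with one of them, so it is a positive scalar and X can be
   rescaled to a unitary matrix. Averaging theta(g^-1) M theta(g) over the group gives a matrix
   that commutes with theta, hence a scalar, whose value is read off from the trace; for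
   M = E_ab X^-1 this is the formula, with cnj x_ab * x_ij on the right-hand side. *)
theory Submission
  imports Defs "HOL-Computational_Algebra.Fundamental_Theorem_Algebra"
begin

section \<open>Scalar matrices, traces and finite sums of matrices\<close>

lemma mat_mul_component: "(mat c ** A) $ i $ j = c * A $ i $ j"
  for A :: "'a::semiring_1 ^ 'm ^ 'n"
  by (simp add: matrix_matrix_mult_def mat_def if_distrib if_distribR cong: if_cong)

lemma mat_mul_commute: "A ** mat c = mat c ** A"
  for A :: "'a::comm_semiring_1 ^ 'n ^ 'n"
  by (simp add: vec_eq_iff mat_mul_component)
    (simp add: matrix_matrix_mult_def mat_def if_distrib if_distribR mult.commute cong: if_cong)

lemma mat_vector_mul: "mat c *v x = c *s x"
  for x :: "'a::semiring_1 ^ 'n"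
  by (simp add: vec_eq_iff matrix_vector_mult_def mat_def if_distrib if_distribR cong: if_cong)

lemma trace_mat: "trace (mat c :: 'a::semiring_1 ^ 'n ^ 'n) = of_nat CARD('n) * c"
  by (simp add: trace_def mat_def)

lemma trace_sum: "trace (sum f S) = (\<Sum>x\<in>S. trace (f x))"
  for f :: "'b \<Rightarrow> 'a::comm_semiring_1 ^ 'n ^ 'n"
  by (simp add: trace_def sum_component) (rule sum.swap)

lemma matrix_mul_sum_right: "A ** sum f S = (\<Sum>x\<in>S. A ** f x)"
  for A :: "'a::semiring_1 ^ 'm ^ 'n"
  by (simp add: vec_eq_iff matrix_matrix_mult_def sum_component sum_distrib_left)
    (intro allI sum.swap)

lemma matrix_mul_sum_left: "sum f S ** A = (\<Sum>x\<in>S. f x ** A)"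
  for A :: "'a::semiring_1 ^ 'm ^ 'n"
  by (simp add: vec_eq_iff matrix_matrix_mult_def sum_component sum_distrib_right)
    (intro allI sum.swap)

lemma matrix_inv_mul:
  assumes "invertible A"
  shows "A ** matrix_inv A = mat 1" and "matrix_inv A ** A = mat 1"
  using someI_ex[OF assms[unfolded invertible_def]] unfolding matrix_inv_def by auto

lemma conj_transpose_mul: "conj_transpose (A ** B) = conj_transpose B ** conj_transpose A"
  by (simp add: conj_transpose_def matrix_matrix_mult_def vec_eq_iff mult.commute)

lemma conj_transpose_mat: "conj_transpose (mat c) = mat (cnj c)"
  by (simp add: conj_transpose_def mat_def vec_eq_iff)

section \<open>Eigenvectors over the complex numbers\<close>

text \<open>Evaluation at \<open>x\<close> is a ring homomorphism, so it passes through the Leibniz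
  formula. This makes determinants of matrices with a parameter accessible to the fundamental
  theorem of algebra.\<close>

lemma ex_poly_det:
  fixes B :: "'a::comm_ring_1 poly ^ 'n ^ 'n"
  obtains p where "\<And>x. poly p x = det (\<chi> i j. poly (B $ i $ j) x)"
proof
  show "poly (det B) x = det (\<chi> i j. poly (B $ i $ j) x)" for x
    by (simp add: det_def poly_sum poly_prod)
qed

text \<open>If every shift were invertible, \<open>det (A + mat x)\<close> would be a polynomial in
  \<open>x\<close> without a root, hence constant. Comparing it with
  \<open>det (mat 1 + mat x ** A)\<close> refutes this without computing the degree of the
  characteristic polynomial.\<close>

lemma complex_matrix_not_invertible_shift:
  fixes A :: "complex ^ 'n ^ 'n"
  shows "\<exists>z. \<not> invertible (A + mat z)"
proof (rule ccontr)
  assume "\<not> ?thesis"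
  hence nz: "det (A + mat z) \<noteq> 0" for z
    by (simp add: invertible_det_nz)
  obtain p where "\<And>x. poly p x =
      det (\<chi> i j. poly ((\<chi> i j. [:A $ i $ j, if i = j then 1 else 0:]) $ i $ j) x)"
    using ex_poly_det by blast
  moreover have "(\<chi> i j. poly ((\<chi> i j. [:A $ i $ j, if i = j then 1 else 0:]) $ i $ j) x)
      = A + mat x" for x
    by (simp add: vec_eq_iff mat_def)
  ultimately have p: "poly p x = det (A + mat x)" for x
    by simp
  obtain q where "\<And>x. poly q x =
      det (\<chi> i j. poly ((\<chi> i j. [:if i = j then 1 else 0, A $ i $ j:]) $ i $ j) x)"
    using ex_poly_det by blast
  moreover have "(\<chi> i j. poly ((\<chi> i j. [:if i = j then 1 else 0, A $ i $ j:]) $ i $ j) x)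
      = mat 1 + mat x ** A" for x
    by (simp add: vec_eq_iff mat_mul_component) (simp add: mat_def)
  ultimately have q: "poly q x = det (mat 1 + mat x ** A)" for x
    by simp
  have "constant (poly p)"
    using fundamental_theorem_of_algebra[of p] nz p by metis
  then obtain c where c: "\<And>x. poly p x = c"
    unfolding constant_def by metis
  (* q is the reversal of p, so a constant p would make q a multiple of x^n, against q(0) = 1. *)
  have "poly q y = poly (monom c CARD('n)) y" if "y \<noteq> 0" for y
  proof -
    have "mat 1 + mat y ** A = mat y ** (A + mat (1 / y))"
      using that by (simp add: vec_eq_iff mat_mul_component) (simp add: mat_def distrib_left)
    moreover have "det (mat y :: complex ^ 'n ^ 'n) = y ^ CARD('n)"
      by (subst det_diagonal) (simp_all add: mat_def)
    ultimately show ?thesis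
      using c[of "1 / y"] by (simp add: q p det_mul poly_monom mult.commute)
  qed
  hence sub: "- {0} \<subseteq> {y. poly (q - monom c CARD('n)) y = 0}"
    by auto
  \<comment> \<open>Agreement at the infinitely many nonzero points makes the two polynomials equal,
    so they may be compared at 0 as well.\<close>
  have "infinite (- {0 :: complex})"
    using infinite_UNIV_char_0 by (metis Compl_eq_Diff_UNIV finite.emptyI finite_Diff2 finite_insert)
  hence "q = monom c CARD('n)"
    using poly_roots_finite[of "q - monom c CARD('n)"] finite_subset[OF sub] by auto
  moreover have "poly q 0 = 1"
    unfolding q by simp
  \<comment> \<open>The monomial vanishes at 0 because its exponent \<open>CARD('n)\<close> is
    positive.\<close>
  ultimately show False
    by (simp add: poly_monom zero_power)
qed

text \<open>A singular shift \<open>A + mat z\<close> kills a nonzero vector, which is an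
  eigenvector of \<open>A\<close> for \<open>- z\<close>.\<close>

lemma complex_matrix_eigenvector:
  fixes A :: "complex ^ 'n ^ 'n"
  obtains z v where "v \<noteq> 0" and "A *v v = z *s v"
proof -
  obtain z where "\<not> invertible (A + mat z)"
    using complex_matrix_not_invertible_shift by blast
  then obtain v where v: "v \<noteq> 0" "(A + mat z) *v v = 0"
    using matrix_left_invertible_ker[of "A + mat z"] by (auto simp: invertible_left_inverse)
  hence "A *v v = (- z) *s v"
    by (simp add: matrix_vector_mult_add_rdistrib mat_vector_mul eq_neg_iff_add_eq_0)
  with v(1) show thesis
    by (rule that)
qed

section \<open>Schur's lemma and averaging over the group\<close>

text \<open>An eigenspace of \<open>A\<close> is invariant under everything that commutes with
  \<open>A\<close>. It contains a nonzero vector, so irreducibility makes it the whole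
  space.\<close>

lemma schur_commuting:
  fixes \<theta> :: "'g \<Rightarrow> complex ^ 'n ^ 'n"
  assumes irr: "irreducible_representation G \<theta>"
    and comm: "\<And>g. g \<in> carrier G \<Longrightarrow> A ** \<theta> g = \<theta> g ** A"
  obtains c where "A = mat c"
proof -
  obtain z v where v: "v \<noteq> 0" "A *v v = z *s v"
    by (rule complex_matrix_eigenvector)
  define W where "W = {w. A *v w = z *s w}"
  have "vec.subspace W"
    by (rule vec.subspaceI)
      (auto simp: W_def matrix_vector_right_distrib vec.scale_right_distrib
        vector_smult_assoc vec.scale mult.commute)
  moreover have "\<theta> g *v w \<in> W" if "g \<in> carrier G" "w \<in> W" for g w
  proof -
    have "A *v (\<theta> g *v w) = \<theta> g *v (A *v w)"
      by (simp add: matrix_vector_mul_assoc comm[OF that(1)])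
    with that(2) show ?thesis
      by (simp add: W_def vec.scale)
  qed
  ultimately have "W = {0} \<or> W = UNIV"
    using irr unfolding irreducible_representation_def by blast
  moreover have "v \<in> W"
    using v by (simp add: W_def)
  ultimately have "A *v w = mat z *v w" for w
    using v(1) by (auto simp: W_def mat_vector_mul)
  hence "A = mat z"
    by (simp add: matrix_eq)
  thus thesis
    by (rule that)
qed

lemma matrix_representation_mult:
  assumes "matrix_representation G \<theta>" "g \<in> carrier G" "h \<in> carrier G"
  shows "\<theta> (g \<otimes>\<^bsub>G\<^esub> h) = \<theta> g ** \<theta> h"
  using assms by (simp add: matrix_representation_def hom_def GL_complex_def)

text \<open>The image of the unit is idempotent and invertible, so one factor cancels.\<close>

lemma matrix_representation_one:
  assumes "group G" "matrix_representation G \<theta>"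
  shows "\<theta> \<one>\<^bsub>G\<^esub> = mat 1"
proof -
  interpret group G by fact
  have inv: "invertible (\<theta> \<one>\<^bsub>G\<^esub>)"
    using assms(2) by (auto simp: matrix_representation_def hom_def GL_complex_def)
  have "\<theta> \<one>\<^bsub>G\<^esub> ** \<theta> \<one>\<^bsub>G\<^esub> = \<theta> \<one>\<^bsub>G\<^esub>"
    using matrix_representation_mult[OF assms(2), of "\<one>\<^bsub>G\<^esub>" "\<one>\<^bsub>G\<^esub>"] by simp
  hence "matrix_inv (\<theta> \<one>\<^bsub>G\<^esub>) ** (\<theta> \<one>\<^bsub>G\<^esub> ** \<theta> \<one>\<^bsub>G\<^esub>) = mat 1"
    by (simp add: matrix_inv_mul[OF inv])
  thus ?thesis
    by (simp add: matrix_mul_assoc matrix_inv_mul[OF inv])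
qed

text \<open>Reindexing the sum shows that it commutes with every \<open>\<theta> h\<close>, so
  Schur's lemma makes it scalar. Each summand has the trace of \<open>M\<close>, and comparing
  traces gives the scalar.\<close>

lemma average_conjugation:
  fixes \<theta> :: "'g \<Rightarrow> complex ^ 'n ^ 'n"
  assumes "group G" and fin: "finite (carrier G)"
    and irr: "irreducible_representation G \<theta>"
  shows "(\<Sum>g\<in>carrier G. \<theta> (inv\<^bsub>G\<^esub> g) ** M ** \<theta> g)
    = mat (of_nat (card (carrier G)) / of_nat CARD('n) * trace M)" (is "?S = _")
proof -
  interpret group G by fact
  have rep: "matrix_representation G \<theta>"
    using irr by (simp add: irreducible_representation_def)
  note mult = matrix_representation_mult[OF rep] and one = matrix_representation_one[OF \<open>group G\<close> rep]
  have "?S ** \<theta> h = \<theta> h ** ?S" if h: "h \<in> carrier G" for h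
  proof -
    have "\<theta> h ** ?S = (\<Sum>g\<in>carrier G. \<theta> (h \<otimes>\<^bsub>G\<^esub> inv\<^bsub>G\<^esub> g) ** M ** \<theta> g)"
      by (auto simp: matrix_mul_sum_right mult h matrix_mul_assoc intro!: sum.cong)
    \<comment> \<open>Substitution of \<open>g h\<close> for \<open>g\<close>: the inverse of
      \<open>g h\<close> cancels the factor \<open>h\<close> on the left.\<close>
    also have "\<dots> = (\<Sum>g\<in>carrier G. \<theta> (inv\<^bsub>G\<^esub> g) ** M ** \<theta> (g \<otimes>\<^bsub>G\<^esub> h))"
      by (rule sum.reindex_bij_witness
          [of _ "\<lambda>g. g \<otimes>\<^bsub>G\<^esub> h" "\<lambda>g. g \<otimes>\<^bsub>G\<^esub> inv\<^bsub>G\<^esub> h"])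
        (use h in \<open>auto simp: m_assoc inv_mult_group\<close>)
    also have "\<dots> = ?S ** \<theta> h"
      by (auto simp: matrix_mul_sum_left mult h matrix_mul_assoc intro!: sum.cong)
    finally show ?thesis by simp
  qed
  then obtain c where c: "?S = mat c"
    using schur_commuting[OF irr] by blast
  have "trace (\<theta> (inv\<^bsub>G\<^esub> g) ** M ** \<theta> g) = trace M" if "g \<in> carrier G" for g
  proof -
    have "trace (\<theta> (inv\<^bsub>G\<^esub> g) ** M ** \<theta> g) = trace (\<theta> g ** \<theta> (inv\<^bsub>G\<^esub> g) ** M)"
      by (simp add: trace_mul_sym[of _ "\<theta> g"] matrix_mul_assoc)
    also have "\<theta> g ** \<theta> (inv\<^bsub>G\<^esub> g) = mat 1"
      using that by (simp add: mult[symmetric] one)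
    finally show ?thesis by simp
  qed
  hence "of_nat CARD('n) * c = of_nat (card (carrier G)) * trace M"
    using arg_cong[OF c, of trace] by (simp add: trace_sum trace_mat)
  hence "c = of_nat (card (carrier G)) / of_nat CARD('n) * trace M"
    by (simp add: field_simps)
  with c show ?thesis by simp
qed

section \<open>The orthogonality average of an intertwined pair\<close>

text \<open>Inserting the matrix unit E_ab turns a product of two entries into one entry of a matrix
  product, so the entrywise group sum becomes a sum of matrices.\<close>

lemma matrix_unit_mul_component:
  fixes P Q :: "'a::semiring_1 ^ 'n ^ 'n"
  shows "(P ** (\<chi> k l. if k = a \<and> l = b then 1 else 0) ** Q) $ i $ j = P $ i $ a * Q $ b $ j"
proof -
  have "(P ** (\<chi> k l. if k = a \<and> l = b then 1 else 0)) $ i $ l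
      = (if l = b then P $ i $ a else 0)" for l
    by (simp add: matrix_matrix_mult_def if_distrib cong: if_cong)
  moreover have "(R ** Q) $ i $ j = (\<Sum>l\<in>UNIV. R $ i $ l * Q $ l $ j)" for R
    by (simp add: matrix_matrix_mult_def)
  ultimately have "(P ** (\<chi> k l. if k = a \<and> l = b then 1 else 0) ** Q) $ i $ j
      = (\<Sum>l\<in>UNIV. (if l = b then P $ i $ a else 0) * Q $ l $ j)"
    by (simp only:)
  thus ?thesis
    by (simp add: if_distrib if_distribR cong: if_cong)
qed

text \<open>In the sum of \<open>\<theta> (inv g) ** E ** \<psi> g\<close> the factor
  \<open>X\<close> of \<open>\<psi> g\<close> moves out to the right. What remains is the average of
  \<open>E ** Y\<close>, a scalar determined by the trace of \<open>E ** Y\<close>. Both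
  \<open>Y = conj_transpose U\<close> and \<open>Y = X = mat 1\<close> are used below.\<close>

lemma orthogonality_average_intertwiner:
  fixes \<theta> \<psi> :: "'g \<Rightarrow> complex ^ 'n ^ 'n"
  assumes "group G" and fin: "finite (carrier G)"
    and irr: "irreducible_representation G \<theta>"
    and YX: "Y ** X = mat 1"
    and \<psi>: "\<And>g. g \<in> carrier G \<Longrightarrow> \<psi> g = Y ** \<theta> g ** X"
  shows "orthogonality_average G \<theta> \<psi> i a b j = Y $ b $ a * X $ i $ j"
proof -
  interpret group G by fact
  define E :: "complex ^ 'n ^ 'n" where "E = (\<chi> k l. if k = a \<and> l = b then 1 else 0)"
  define n N where "n = (of_nat CARD('n) :: complex)" and "N = (of_nat (card (carrier G)) :: complex)"
  have "N \<noteq> 0"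
    using fin one_closed by (auto simp: N_def card_eq_0_iff)
  have "n \<noteq> 0"
    by (simp add: n_def)
  \<comment> \<open>The factor \<open>mat 1\<close> brings the product into the shape of
    \<open>matrix_unit_mul_component\<close>.\<close>
  have "trace (E ** Y) = trace (mat 1 ** E ** Y)"
    by simp
  also have "\<dots> = (\<Sum>k\<in>UNIV. (mat 1 :: complex ^ 'n ^ 'n) $ k $ a * Y $ b $ k)"
    unfolding trace_def E_def matrix_unit_mul_component ..
  also have "\<dots> = Y $ b $ a"
    by (simp add: mat_def if_distrib if_distribR cong: if_cong)
  finally have tr: "trace (E ** Y) = Y $ b $ a" .
  have "(\<Sum>g\<in>carrier G. \<theta> (inv\<^bsub>G\<^esub> g) $ i $ a * \<psi> g $ b $ j)
      = (\<Sum>g\<in>carrier G. \<theta> (inv\<^bsub>G\<^esub> g) ** E ** \<psi> g) $ i $ j"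
    by (simp add: E_def matrix_unit_mul_component sum_component)
  also have "(\<Sum>g\<in>carrier G. \<theta> (inv\<^bsub>G\<^esub> g) ** E ** \<psi> g)
      = (\<Sum>g\<in>carrier G. \<theta> (inv\<^bsub>G\<^esub> g) ** (E ** Y) ** \<theta> g) ** X"
    unfolding matrix_mul_sum_left by (intro sum.cong) (auto simp: \<psi> matrix_mul_assoc)
  also have "\<dots> $ i $ j = N / n * Y $ b $ a * X $ i $ j"
    unfolding average_conjugation[OF \<open>group G\<close> fin irr] tr mat_mul_component n_def N_def ..
  finally show ?thesis
    using \<open>N \<noteq> 0\<close> \<open>n \<noteq> 0\<close> by (simp add: orthogonality_average_def n_def N_def)
qed

section \<open>Rescaling an intertwiner to a unitary matrix\<close>

text \<open>Unitarity of both representations makes the conjugate transpose of \<open>X\<close> an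
  intertwiner in the opposite direction, so its product with \<open>X\<close> commutes with
  \<open>\<psi>\<close>.\<close>

lemma unitary_intertwiner:
  fixes \<theta> \<psi> :: "'g \<Rightarrow> complex ^ 'n ^ 'n"
  assumes "unitary_representation G \<theta>" and "unitary_representation G \<psi>"
    and irr: "irreducible_representation G \<psi>"
    and "equivalent_representations G \<theta> \<psi>"
  obtains U where "unitary_matrix U"
    and "\<And>g. g \<in> carrier G \<Longrightarrow> \<psi> g = conj_transpose U ** \<theta> g ** U"
proof -
  from assms(4) obtain X where inv: "invertible X"
    and X: "\<And>g. g \<in> carrier G \<Longrightarrow> matrix_inv X ** \<theta> g ** X = \<psi> g"
    unfolding equivalent_representations_def by blast
  let ?X' = "conj_transpose X"
  have tX: "\<theta> g ** X = X ** \<psi> g" if "g \<in> carrier G" for g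
    by (simp add: X[OF that, symmetric] matrix_mul_assoc matrix_inv_mul[OF inv])
  have X't: "?X' ** \<theta> g = \<psi> g ** ?X'" if g: "g \<in> carrier G" for g
  proof -
    have ut: "conj_transpose (\<theta> g) ** \<theta> g = mat 1" and up: "\<psi> g ** conj_transpose (\<psi> g) = mat 1"
      using assms(1,2) g by (auto simp: unitary_representation_def unitary_matrix_def)
    \<comment> \<open>The conjugate transpose of \<open>tX\<close>, multiplied by
      \<open>\<psi> g\<close> on the left and \<open>\<theta> g\<close> on the right, where
      unitarity cancels one factor on each side.\<close>
    have "\<psi> g ** (?X' ** conj_transpose (\<theta> g)) ** \<theta> g
        = \<psi> g ** (conj_transpose (\<psi> g) ** ?X') ** \<theta> g"
      using arg_cong[OF tX[OF g], of conj_transpose] by (simp add: conj_transpose_mul)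
    moreover have "\<psi> g ** (?X' ** conj_transpose (\<theta> g)) ** \<theta> g = \<psi> g ** ?X'"
      by (simp add: matrix_mul_assoc[symmetric] ut)
    moreover have "\<psi> g ** (conj_transpose (\<psi> g) ** ?X') ** \<theta> g = ?X' ** \<theta> g"
      by (simp add: matrix_mul_assoc up)
    ultimately show ?thesis by simp
  qed
  have "(?X' ** X) ** \<psi> g = \<psi> g ** (?X' ** X)" if "g \<in> carrier G" for g
    using tX[OF that] X't[OF that] by (metis matrix_mul_assoc)
  then obtain c where c: "?X' ** X = mat c"
    using schur_commuting[OF irr] by blast
  \<comment> \<open>The diagonal entries of \<open>?X' ** X\<close> are the squared norms of the
    columns of \<open>X\<close>, so \<open>c\<close> is real and all columns have the same
    norm.\<close>
  have c_sum: "c = of_real (\<Sum>k\<in>UNIV. (cmod (X $ k $ i))\<^sup>2)" for i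
  proof -
    have "c = (?X' ** X) $ i $ i"
      by (simp add: c mat_def)
    also have "\<dots> = (\<Sum>k\<in>UNIV. cnj (X $ k $ i) * X $ k $ i)"
      by (simp add: matrix_matrix_mult_def conj_transpose_def)
    also have "\<dots> = of_real (\<Sum>k\<in>UNIV. (cmod (X $ k $ i))\<^sup>2)"
      by (simp add: complex_norm_square mult.commute del: of_real_power)
    finally show ?thesis .
  qed
  \<comment> \<open>Any column would do, since \<open>c_sum\<close> gives the same value for each;
    \<open>undefined\<close> merely names one index.\<close>
  define d where "d = (\<Sum>k\<in>UNIV. (cmod (X $ k $ undefined))\<^sup>2)"
  have cd: "c = of_real d"
    unfolding d_def by (rule c_sum)
  have "d \<noteq> 0"
  proof
    assume "d = 0"
    hence "X $ k $ i = 0" for k i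
      using c_sum[of i] cd by (simp add: sum_nonneg_eq_0_iff flip: of_real_power of_real_sum)
    hence "X = 0"
      by (simp add: vec_eq_iff)
    hence "mat 1 = (0 :: complex ^ 'n ^ 'n)"
      using matrix_inv_mul[OF inv] by (simp add: matrix_matrix_mult_def vec_eq_iff)
    thus False
      by (auto simp: mat_def vec_eq_iff split: if_splits)
  qed
  moreover have "d \<ge> 0"
    by (simp add: d_def sum_nonneg)
  ultimately have "d > 0" by simp
  \<comment> \<open>Scaling by \<open>s\<close> divides every column of \<open>X\<close> by its
    norm.\<close>
  define s :: complex where "s = of_real (1 / sqrt d)"
  have s: "cnj s * s * c = 1"
    using \<open>d > 0\<close> by (simp add: s_def cd flip: of_real_mult)
  define U where "U = mat s ** X"
  have U': "conj_transpose U = mat (cnj s) ** ?X'"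
    by (simp add: U_def conj_transpose_mul conj_transpose_mat mat_mul_commute)
  have mm: "mat x ** mat y = (mat (x * y) :: complex ^ 'n ^ 'n)" for x y
    by (simp add: vec_eq_iff mat_mul_component) (simp add: mat_def)
  have "conj_transpose U ** U = mat (cnj s) ** (?X' ** mat s) ** X"
    unfolding U' unfolding U_def by (simp add: matrix_mul_assoc)
  also have "\<dots> = mat (cnj s) ** mat s ** (?X' ** X)"
    unfolding mat_mul_commute[of ?X'] by (simp add: matrix_mul_assoc)
  also have "\<dots> = mat 1"
    by (simp add: c mm s)
  finally have U'U: "conj_transpose U ** U = mat 1" .
  hence "unitary_matrix U"
    by (simp add: unitary_matrix_def matrix_left_right_inverse)
  moreover have "\<psi> g = conj_transpose U ** \<theta> g ** U" if "g \<in> carrier G" for g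
  proof -
    have "\<theta> g ** U = U ** \<psi> g"
      using tX[OF that] by (metis U_def mat_mul_commute matrix_mul_assoc)
    thus ?thesis
      by (metis U'U matrix_mul_assoc matrix_mul_lid)
  qed
  ultimately show thesis
    by (rule that)
qed

section \<open>The orthogonality formula and its classical case\<close>

text \<open>Values outside \<open>carrier G\<close> are arbitrary, so the representations are
  compared on the carrier only. In the case of equality the exact formula, with no phase,
  characterizes the identity matrix among unitary matrices.\<close>

theorem mainTheorem2:
  fixes G :: "('g, 'r) monoid_scheme"
    and \<theta> \<psi> :: "'g \<Rightarrow> complex ^ 'n ^ 'n"
  assumes "group G" and "finite (carrier G)"
    and "unitary_representation G \<theta>" and "irreducible_representation G \<theta>"
    and "unitary_representation G \<psi>" and "irreducible_representation G \<psi>"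
    and "equivalent_representations G \<theta> \<psi>"
  shows "((\<exists>g\<in>carrier G. \<theta> g \<noteq> \<psi> g) \<longrightarrow>
      (\<exists>U :: complex ^ 'n ^ 'n. unitary_matrix U \<and>
        (\<forall>a b. \<exists>\<omega> :: complex. cmod \<omega> = 1 \<and>
          (\<forall>i j. of_real (cmod (U $ a $ b)) * (\<omega> * U $ i $ j)
                  = orthogonality_average G \<theta> \<psi> i a b j))))
    \<and> ((\<forall>g\<in>carrier G. \<theta> g = \<psi> g) \<longrightarrow>
      (\<forall>U :: complex ^ 'n ^ 'n.
        (unitary_matrix U \<and>
          (\<forall>a b i j. of_real (cmod (U $ a $ b)) * U $ i $ j
                  = orthogonality_average G \<theta> \<psi> i a b j))
        \<longleftrightarrow> U = mat 1) \<and>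
      (\<forall>a b i j. orthogonality_average G \<theta> \<theta> i a b j
                  = (if a = b then 1 else 0) * (if i = j then 1 else 0)))"
proof (intro conjI impI)
  obtain U where U: "unitary_matrix U"
    and \<psi>: "\<And>g. g \<in> carrier G \<Longrightarrow> \<psi> g = conj_transpose U ** \<theta> g ** U"
    using unitary_intertwiner[OF assms(3,5,6,7)] by blast
  have U'U: "conj_transpose U ** U = mat 1"
    using U by (simp add: unitary_matrix_def)
  have avg: "orthogonality_average G \<theta> \<psi> i a b j = cnj (U $ a $ b) * U $ i $ j" for i a b j
    using orthogonality_average_intertwiner[OF assms(1,2,4) U'U \<psi>]
    by (simp add: conj_transpose_def)
  have "\<exists>\<omega> :: complex. cmod \<omega> = 1 \<and>
      (\<forall>i j. of_real (cmod (U $ a $ b)) * (\<omega> * U $ i $ j)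
          = orthogonality_average G \<theta> \<psi> i a b j)" for a b
  proof (cases "U $ a $ b = 0")
    \<comment> \<open>Both sides vanish, so any unimodular factor serves.\<close>
    case True
    thus ?thesis
      by (intro exI[of _ 1]) (simp add: avg)
  next
    case False
    thus ?thesis
      \<comment> \<open>The conjugate phase of the entry: multiplied by the modulus it gives back
        \<open>cnj (U $ a $ b)\<close>.\<close>
      by (intro exI[of _ "cnj (U $ a $ b) / of_real (cmod (U $ a $ b))"])
        (simp add: avg norm_divide)
  qed
  with U show "\<exists>U :: complex ^ 'n ^ 'n. unitary_matrix U \<and>
        (\<forall>a b. \<exists>\<omega> :: complex. cmod \<omega> = 1 \<and>
          (\<forall>i j. of_real (cmod (U $ a $ b)) * (\<omega> * U $ i $ j)
                  = orthogonality_average G \<theta> \<psi> i a b j))"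
    by blast
next
  \<comment> \<open>Here \<open>mat 1\<close> is the intertwiner. Stating this for every
    \<open>\<phi>\<close> that agrees with \<open>\<theta>\<close> on the carrier covers both
    \<open>\<theta>\<close> and \<open>\<psi>\<close>.\<close>
  have classical: "orthogonality_average G \<theta> \<phi> i a b j
      = (if a = b then 1 else 0) * (if i = j then 1 else 0)"
    if "\<And>g. g \<in> carrier G \<Longrightarrow> \<phi> g = \<theta> g" for \<phi> i a b j
  proof -
    have "orthogonality_average G \<theta> \<phi> i a b j = mat 1 $ b $ a * mat 1 $ i $ j"
      by (rule orthogonality_average_intertwiner[OF assms(1,2,4)]) (simp_all add: that)
    thus ?thesis
      by (auto simp: mat_def)
  qed
  show "\<forall>a b i j. orthogonality_average G \<theta> \<theta> i a b j
      = (if a = b then 1 else 0) * (if i = j then 1 else 0)"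
    using classical[of \<theta>] by simp
  assume "\<forall>g\<in>carrier G. \<theta> g = \<psi> g"
  hence avg: "orthogonality_average G \<theta> \<psi> i a b j
      = (if a = b then 1 else 0) * (if i = j then 1 else 0)" for i a b j
    by (intro classical) simp
  show "\<forall>U :: complex ^ 'n ^ 'n.
        (unitary_matrix U \<and>
          (\<forall>a b i j. of_real (cmod (U $ a $ b)) * U $ i $ j
                  = orthogonality_average G \<theta> \<psi> i a b j))
        \<longleftrightarrow> U = mat 1"
  proof (intro allI iffI)
    fix U :: "complex ^ 'n ^ 'n"
    assume "unitary_matrix U \<and>
        (\<forall>a b i j. of_real (cmod (U $ a $ b)) * U $ i $ j
            = orthogonality_average G \<theta> \<psi> i a b j)"
    \<comment> \<open>The formula for \<open>a = b = k\<close>. With \<open>i = j = k\<close> its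
      modulus shows that the diagonal entries have modulus 1, and then it determines every entry of
      \<open>U\<close>.\<close>
    hence *: "of_real (cmod (U $ k $ k)) * U $ i $ j = (if i = j then 1 else 0)" for k i j
      by (simp add: avg)
    have "cmod (U $ k $ k) = 1" for k
    proof -
      have "(cmod (U $ k $ k))\<^sup>2 = 1"
        using arg_cong[OF *[of k k k], of cmod] by (simp add: norm_mult power2_eq_square)
      thus ?thesis
        by (simp add: power2_eq_1_iff) (use norm_ge_zero[of "U $ k $ k"] in linarith)
    qed
    with * show "U = mat 1"
      by (simp add: vec_eq_iff mat_def)
  next
    fix U :: "complex ^ 'n ^ 'n"
    assume "U = mat 1"
    thus "unitary_matrix U \<and>
        (\<forall>a b i j. of_real (cmod (U $ a $ b)) * U $ i $ j
            = orthogonality_average G \<theta> \<psi> i a b j)"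
      by (simp add: avg unitary_matrix_def conj_transpose_mat) (simp add: mat_def)
  qed
qed

end
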